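(* Let $G, H$ be multiplicative subgroups of $\mathbb{F}_p$ (that is, subgroups of $\mathbb{F}_p^*$) with $|G|, |H| \leq \sqrt{p}$, and let $0 \neq d \in \mathbb{F}_p$ be fixed. Then the number of solutions to $$g - h = d, \qquad g \in G,\ h \in H,$$ is bounded by $$\max\{|G|, |H|\}^{26/27}.$$
   Context: Here $p$ is a prime, $\mathbb{F}_p$ is the field with $p$ elements, and $\mathbb{F}_p^*$ is its multiplicative group of non-zero elements. $|X|$ denotes the number of elements of a finite set $X$. *)

theory Defs
  imports Complex_Main "HOL-Number_Theory.Residues"
begin

text \<open>
  The field \<open>F_p\<close> is \<^term>\<open>residue_ring (int p)\<close>, with carrier \<open>{0..int p - 1}\<close>; its
  multiplicative group of non-zero elements is \<^term>\<open>mult_of (residue_ring (int p))\<close>.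
\<close>

end

theory Submission
  imports Defs "HOL-Computational_Algebra.Polynomial"
begin

text \<open>
  Stepanov's method. A solution \<open>g - h = d\<close> is a common root \<open>s = g\<close> of \<open>X^m - 1\<close> and
  \<open>(X - d)^n - 1\<close>, where \<open>m = |G|\<close>, \<open>n = |H|\<close>, and we may assume \<open>m \<le> n\<close>. Consider
  \<open>F = \<Sum> x(a,b,c) X^a X^(m b) (X - d)^(n c)\<close> with \<open>a < A\<close> and \<open>b, c < B\<close>. At a common root the
  powers \<open>X^(m b)\<close> and \<open>(X - d)^(n c)\<close> take the value 1, so that \<open>F\<close> vanishes to order \<open>D\<close> at all
  of them as soon as about \<open>A D + D^2/2\<close> linear equations in the \<open>A B^2\<close> unknowns \<open>x(a,b,c)\<close> hold.
  A nonzero solution gives \<open>F \<noteq> 0\<close> if \<open>A \<le> m\<close> and \<open>A B \<le> n\<close>, because a nonzero polynomial with at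
  most \<open>n\<close> terms is not divisible by \<open>(X - d)^n\<close>. Comparing with the degree of \<open>F\<close>, the number \<open>N\<close> of
  common roots satisfies \<open>D N \<le> A - 1 + (m + n) (B - 1)\<close>.

  With \<open>A = D = 2 r^2\<close>, \<open>B = 2 r\<close> and \<open>r\<close> about \<open>(n/4)^(1/3)\<close> this gives \<open>N \<le> 2 n / r\<close>, which is
  below \<open>n^(26/27)\<close> for \<open>n \<ge> 256\<close>; the choice \<open>A = 4\<close>, \<open>B = 2\<close>, \<open>D = 3\<close> handles
  \<open>8 \<le> n < 256\<close>, and for \<open>2 \<le> n \<le> 7\<close> the bound \<open>N \<le> n - 1\<close> suffices.

  Polynomials over the field with \<open>q\<close> elements are integer polynomials up to multiples of the
  constant polynomial \<open>[:q:]\<close>.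
\<close>

section \<open>Divisibility and coprimality modulo \<open>q\<close>\<close>

definition mod_dvd :: "int \<Rightarrow> int poly \<Rightarrow> int poly \<Rightarrow> bool" where
  "mod_dvd q W F \<longleftrightarrow> (\<exists>Q. [:q:] dvd F - W * Q)"

lemma const_dvd_imp_dvd_poly:
  fixes F :: "int poly"
  assumes "[:q:] dvd F"
  shows "q dvd poly F x"
  using assms by (auto elim!: dvdE)

lemma const_dvd_pderiv:
  fixes F :: "int poly"
  assumes "[:q:] dvd F"
  shows "[:q:] dvd pderiv F"
  using assms by (simp add: const_poly_dvd_iff coeff_pderiv)

lemma dvd_imp_mod_dvd: "W dvd F \<Longrightarrow> mod_dvd q W F"
  unfolding mod_dvd_def by (metis diff_self dvd_0_right dvd_def)

lemma mod_dvd_imp_dvd_poly: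
  assumes "mod_dvd q W F" "q dvd poly W x"
  shows "q dvd poly F x"
proof -
  obtain Q where "[:q:] dvd F - W * Q" using assms(1) by (auto simp: mod_dvd_def)
  from const_dvd_imp_dvd_poly[OF this, of x]
  have "q dvd (poly F x - poly W x * poly Q x) + poly W x * poly Q x"
    using assms(2) by (intro dvd_add) auto
  then show ?thesis by simp
qed

lemma mod_dvd_linear_iff: "mod_dvd q [:-s, 1:] F \<longleftrightarrow> q dvd poly F s"
proof
  assume "q dvd poly F s"
  moreover have "F - [:-s, 1:] * synthetic_div F s = [:poly F s:]"
    using synthetic_div_correct'[of s F] by (metis add_diff_cancel_left')
  ultimately have "[:q:] dvd F - [:-s, 1:] * synthetic_div F s" by simp
  then show "mod_dvd q [:-s, 1:] F" by (auto simp: mod_dvd_def)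
qed (simp add: mod_dvd_imp_dvd_poly)

text \<open>Reduce the cofactor to \<open>R\<close> with coefficients in \<open>{0..<q}\<close>. As
  \<open>W\<close> is monic, the top coefficient of \<open>W * R\<close> is that of
  \<open>R\<close>, nonzero and below \<open>q\<close>; it could only be cancelled modulo
  \<open>q\<close> by a term of \<open>F\<close>.\<close>

lemma mod_dvd_degree_le:
  assumes q: "q > 0" and W: "lead_coeff W = 1" and "mod_dvd q W F" "\<not> [:q:] dvd F"
  shows "degree W \<le> degree F"
proof (rule ccontr)
  assume less: "\<not> degree W \<le> degree F"
  obtain Q where Q: "[:q:] dvd F - W * Q" using assms by (auto simp: mod_dvd_def)
  define R where "R = map_poly (\<lambda>x. x mod q) Q"
  have cR: "coeff R k = coeff Q k mod q" for k by (simp add: R_def coeff_map_poly)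
  have "[:q:] dvd Q - R" by (simp add: const_poly_dvd_iff cR)
  then have "[:q:] dvd (F - W * Q) + W * (Q - R)" using Q by (intro dvd_add) auto
  then have FR: "[:q:] dvd F - W * R" by (simp add: algebra_simps)
  with \<open>\<not> [:q:] dvd F\<close> have "R \<noteq> 0" by auto
  have "q dvd coeff (F - W * R) (degree W + degree R)"
    using FR by (simp add: const_poly_dvd_iff)
  also have "\<dots> = - lead_coeff R"
    using less W by (simp add: coeff_mult_degree_sum coeff_eq_0)
  finally have "q dvd lead_coeff R" by simp
  moreover have "lead_coeff R mod q = lead_coeff R" unfolding cR by simp
  ultimately show False using \<open>R \<noteq> 0\<close> by simp
qed

text \<open>A Bezout identity can be multiplied and substituted directly, with no gcd of polynomials
  over the residue field.\<close>

definition mod_coprime :: "int \<Rightarrow> int poly \<Rightarrow> int poly \<Rightarrow> bool" where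
  "mod_coprime q A B \<longleftrightarrow> (\<exists>U V. [:q:] dvd U * A + V * B - 1)"

lemma mod_coprime_commute: "mod_coprime q A B \<longleftrightarrow> mod_coprime q B A"
  unfolding mod_coprime_def by (metis add.commute)

lemma mod_coprime_1: "mod_coprime q A 1"
  unfolding mod_coprime_def by (rule exI[of _ 0], rule exI[of _ 1]) simp

lemma mod_coprime_mult:
  assumes "mod_coprime q A B" "mod_coprime q A C"
  shows "mod_coprime q A (B * C)"
proof -
  obtain U V where 1: "[:q:] dvd U * A + V * B - 1"
    using assms(1) by (auto simp: mod_coprime_def)
  obtain U' V' where 2: "[:q:] dvd U' * A + V' * C - 1"
    using assms(2) by (auto simp: mod_coprime_def)
  have "[:q:] dvd (U * A + V * B - 1) * (U' * A + V' * C) + (U' * A + V' * C - 1)"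
    by (rule dvd_add[OF dvd_mult2[OF 1] 2])
  also have "\<dots> = (U * U' * A + U * V' * C + V * B * U') * A + (V * V') * (B * C) - 1"
    by (simp add: algebra_simps)
  finally show ?thesis unfolding mod_coprime_def by blast
qed

lemma mod_coprime_prod:
  assumes "\<And>i. i \<in> I \<Longrightarrow> mod_coprime q A (f i)"
  shows "mod_coprime q A (\<Prod>i\<in>I. f i)"
  using assms by (induction I rule: infinite_finite_induct) (auto intro: mod_coprime_mult mod_coprime_1)

lemma mod_coprime_power: "mod_coprime q A B \<Longrightarrow> mod_coprime q A (B ^ k)"
  by (induction k) (auto intro: mod_coprime_mult mod_coprime_1)

lemma mod_coprime_linear:
  assumes "prime q" "\<not> q dvd s - t"
  shows "mod_coprime q [:-s, 1:] [:-t, 1:]"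
proof -
  have "coprime q (s - t)" using assms by (rule prime_imp_coprime)
  then obtain u v where "u * q + v * (s - t) = 1"
    by (metis bezout_int coprime_imp_gcd_eq_1)
  then have "[:-v:] * [:-s, 1:] + [:v:] * [:-t, 1:] - 1 = [:q:] * [:-u:]"
    by (simp add: one_pCons algebra_simps)
  then show ?thesis unfolding mod_coprime_def by (metis dvd_triv_left)
qed

text \<open>Multiply \<open>U * A + V * B = 1\<close> by \<open>F\<close>, then replace
  \<open>F\<close> by \<open>B * R\<close> in the first summand and by \<open>A * Q\<close> in the
  second.\<close>

lemma mod_dvd_mult_coprime:
  assumes "mod_coprime q A B" "mod_dvd q A F" "mod_dvd q B F"
  shows "mod_dvd q (A * B) F"
proof -
  obtain U V where UV: "[:q:] dvd U * A + V * B - 1"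
    using assms(1) by (auto simp: mod_coprime_def)
  obtain Q where Q: "[:q:] dvd F - A * Q" using assms(2) by (auto simp: mod_dvd_def)
  obtain R where R: "[:q:] dvd F - B * R" using assms(3) by (auto simp: mod_dvd_def)
  have "[:q:] dvd (U * A) * (F - B * R) + (V * B) * (F - A * Q) - F * (U * A + V * B - 1)"
    by (rule dvd_diff[OF dvd_add[OF dvd_mult[OF R] dvd_mult[OF Q]] dvd_mult[OF UV]])
  also have "\<dots> = F - (A * B) * (U * R + V * Q)" by (simp add: algebra_simps)
  finally show ?thesis by (auto simp: mod_dvd_def)
qed

text \<open>The powers of \<open>X - s\<close> for points distinct modulo \<open>q\<close> are
  pairwise coprime, so their product, monic of degree \<open>D * card S\<close>, divides
  \<open>F\<close> modulo \<open>q\<close>.\<close>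

lemma mult_card_roots_le_degree:
  assumes q: "prime q" and S: "finite S" "inj_on (\<lambda>s. s mod q) S"
    and dvd: "\<And>s. s \<in> S \<Longrightarrow> mod_dvd q ([:-s, 1:] ^ D) F"
    and F: "\<not> [:q:] dvd F"
  shows "D * card S \<le> degree F"
proof -
  have "mod_dvd q (\<Prod>s\<in>S. [:-s, 1:] ^ D) F" using S dvd
  proof (induction S rule: finite_induct)
    case (insert t S)
    have "mod_coprime q ([:-t, 1:] ^ D) (\<Prod>s\<in>S. [:-s, 1:] ^ D)"
    proof (rule mod_coprime_prod)
      fix s assume "s \<in> S"
      then have "\<not> q dvd t - s" using insert by (auto simp: mod_eq_dvd_iff)
      then have "mod_coprime q [:-t, 1:] [:-s, 1:]" using q by (intro mod_coprime_linear)
      then show "mod_coprime q ([:-t, 1:] ^ D) ([:-s, 1:] ^ D)"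
        by (metis mod_coprime_commute mod_coprime_power)
    qed
    then show ?case using insert by (auto intro!: mod_dvd_mult_coprime)
  qed (auto intro: dvd_imp_mod_dvd)
  moreover have "lead_coeff (\<Prod>s\<in>S. [:-s, 1:] ^ D) = 1"
    by (simp add: lead_coeff_prod lead_coeff_power)
  ultimately have "degree (\<Prod>s\<in>S. [:-s, 1:] ^ D) \<le> degree F"
    using q F by (intro mod_dvd_degree_le) (auto simp: prime_gt_0_int)
  moreover have "degree (\<Prod>s\<in>S. [:-s, 1:] ^ D) = D * card S"
    by (subst degree_prod_eq_sum_degree) (auto simp: degree_power_eq)
  ultimately show ?thesis by simp
qed

section \<open>Order of vanishing from iterated derivations\<close>

text \<open>Gauss's lemma: a prime \<open>q\<close> stays prime as a constant polynomial.\<close>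

lemma const_dvd_mult_iff:
  fixes F G :: "int poly"
  assumes "prime q"
  shows "[:q:] dvd F * G \<longleftrightarrow> [:q:] dvd F \<or> [:q:] dvd G"
  by (intro prime_elem_dvd_mult_iff prime_imp_prime_elem[THEN prime_elem_const_poly_iff[THEN iffD2]] assms)

lemma not_const_dvd_monic:
  fixes W :: "int poly"
  assumes "prime q" "lead_coeff W = 1"
  shows "\<not> [:q:] dvd W"
proof
  assume "[:q:] dvd W"
  then have "q dvd lead_coeff W" by (simp only: const_poly_dvd_iff)
  with assms show False by auto
qed

lemma mod_dvd_power_pderiv:
  assumes "mod_dvd q (W ^ Suc k) F"
  shows "mod_dvd q (W ^ k) (pderiv F)"
proof -
  obtain Q where Q: "[:q:] dvd F - W ^ Suc k * Q" using assms by (auto simp: mod_dvd_def)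
  have "pderiv (F - W ^ Suc k * Q) =
      pderiv F - W ^ k * (W * pderiv Q + smult (1 + int k) (pderiv W * Q))"
    by (simp only: pderiv_diff pderiv_mult pderiv_power_Suc) (simp add: algebra_simps)
  then show ?thesis using const_dvd_pderiv[OF Q] unfolding mod_dvd_def by metis
qed

text \<open>A Taylor criterion without factorials. By induction \<open>W ^ D\<close> divides both
  \<open>F = W ^ D * U\<close> and \<open>\<theta> * pderiv F\<close>, which forces
  \<open>D * \<theta> * U\<close> to vanish at \<open>s\<close>. For \<open>0 < D < q\<close> the
  factor \<open>D\<close> is invertible, so \<open>U\<close> gives one more factor \<open>W\<close>;
  \<open>D = 0\<close> is the remainder theorem.\<close>

lemma mod_dvd_power_derivation:
  assumes q: "prime q" and \<theta>: "\<not> q dvd poly \<theta> s" and "int D \<le> q"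
    and "\<And>k. k < D \<Longrightarrow> q dvd poly (((\<lambda>F. \<theta> * pderiv F) ^^ k) F) s"
  shows "mod_dvd q ([:-s, 1:] ^ D) F"
  using assms(3,4)
proof (induction D arbitrary: F)
  case 0
  then show ?case by (auto intro: dvd_imp_mod_dvd)
next
  case (Suc D)
  show ?case
  proof (cases D)
    case 0
    then show ?thesis using Suc.prems(2)[of 0] mod_dvd_linear_iff by simp
  next
    case (Suc E)
    define W where "W = [:-s, 1:]"
    have W: "pderiv W = 1" "lead_coeff W = 1" "poly W s = 0" by (simp_all add: W_def pderiv_pCons)
    have "mod_dvd q (W ^ D) F" unfolding W_def using Suc.prems by (intro Suc.IH) auto
    then obtain U where U: "[:q:] dvd F - W ^ D * U" by (auto simp: mod_dvd_def)
    have "mod_dvd q (W ^ D) (\<theta> * pderiv F)"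
      unfolding W_def
    proof (rule Suc.IH)
      fix k assume "k < D"
      then show "q dvd poly (((\<lambda>F. \<theta> * pderiv F) ^^ k) (\<theta> * pderiv F)) s"
        using Suc.prems(2)[of "Suc k"] by (simp only: funpow_Suc_right o_def)
    qed (use Suc.prems in auto)
    then obtain V where V: "[:q:] dvd \<theta> * pderiv F - W ^ D * V" by (auto simp: mod_dvd_def)
    \<comment> \<open>Two expressions for \<open>\<theta> * pderiv F\<close> are compared;
      differentiating \<open>W ^ D\<close> loses one power, so only \<open>W ^ E\<close> with
      \<open>E = D - 1\<close> is cancelled.\<close>
    have "[:q:] dvd (\<theta> * pderiv F - W ^ D * V) - \<theta> * pderiv (F - W ^ D * U)"
      by (rule dvd_diff[OF V dvd_mult[OF const_dvd_pderiv[OF U]]])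
    also have "\<dots> = W ^ E * (smult (int D) (\<theta> * U) - W * (V - \<theta> * pderiv U))"
      unfolding Suc
      by (simp only: pderiv_diff pderiv_mult pderiv_power_Suc W) (simp add: algebra_simps)
    finally have "[:q:] dvd smult (int D) (\<theta> * U) - W * (V - \<theta> * pderiv U)"
      using not_const_dvd_monic[OF q, of "W ^ E"]
      by (simp only: const_dvd_mult_iff[OF q] lead_coeff_power W) simp
    from const_dvd_imp_dvd_poly[OF this, of s]
    have "q dvd int D * (poly \<theta> s * poly U s)" by (simp add: W)
    moreover have "\<not> q dvd int D"
      using Suc.prems(1) Suc by (auto dest: zdvd_imp_le)
    ultimately have "q dvd poly U s" using q \<theta> by (auto simp: prime_dvd_mult_iff)
    then obtain T where T: "[:q:] dvd U - W * T"
      unfolding W_def mod_dvd_linear_iff[symmetric] by (auto simp: mod_dvd_def)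
    have "[:q:] dvd (F - W ^ D * U) + W ^ D * (U - W * T)"
      by (rule dvd_add[OF U dvd_mult[OF T]])
    also have "\<dots> = F - W ^ Suc D * T" by (simp add: algebra_simps)
    finally show ?thesis unfolding W_def mod_dvd_def by blast
  qed
qed

section \<open>Polynomials with few terms\<close>

text \<open>Removing one exponent by a first order operator costs one order of vanishing at
  \<open>d\<close>, so \<open>card E\<close> orders suffice to remove all of them. Exponents below
  \<open>q\<close> have differences that are invertible modulo \<open>q\<close>.\<close>

lemma sparse_mod_dvd_imp_zero:
  assumes q: "prime q" and d: "\<not> q dvd d"
    and "finite E" "\<And>k. k \<in> E \<Longrightarrow> int k < q"
    and "\<And>k. k \<notin> E \<Longrightarrow> q dvd coeff F k"
    and "mod_dvd q ([:-d, 1:] ^ card E) F"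
  shows "[:q:] dvd F"
  using assms(3-)
proof (induction E arbitrary: F rule: finite_induct)
  case empty
  then show ?case by (simp add: const_poly_dvd_iff)
next
  case (insert e E)
  let ?W = "[:-d, 1:]"
  txt \<open>The operator \<open>X d/dX - e\<close> kills the term of exponent \<open>e\<close> and no other one.\<close>
  define G where "G = pCons 0 (pderiv F) - smult (int e) F"
  have cG: "coeff G k = (int k - int e) * coeff F k" for k
    by (cases k) (simp_all add: G_def coeff_pderiv algebra_simps)
  have div: "mod_dvd q (?W ^ Suc (card E)) F" using insert by simp
  then have "mod_dvd q (?W ^ card E) (pderiv F)" by (rule mod_dvd_power_pderiv)
  then obtain Q where Q: "[:q:] dvd pderiv F - ?W ^ card E * Q" by (auto simp: mod_dvd_def)
  obtain R where R: "[:q:] dvd F - ?W ^ Suc (card E) * R" using div by (auto simp: mod_dvd_def)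
  have "[:q:] dvd [:0, 1:] * (pderiv F - ?W ^ card E * Q) - [:int e:] * (F - ?W ^ Suc (card E) * R)"
    by (rule dvd_diff[OF dvd_mult[OF Q] dvd_mult[OF R]])
  also have "\<dots> = G - ?W ^ card E * ([:0, 1:] * Q - [:int e:] * ?W * R)"
    by (simp add: G_def algebra_simps)
  finally have divG: "mod_dvd q (?W ^ card E) G" by (auto simp: mod_dvd_def)
  have G: "[:q:] dvd G"
  proof (rule insert.IH)
    show "q dvd coeff G k" if "k \<notin> E" for k
      using that insert.prems(2)[of k] by (cases "k = e") (auto simp: cG)
  qed (use insert.prems divG in auto)
  have other: "q dvd coeff F k" if "k \<noteq> e" for k
  proof (cases "k \<in> insert e E")
    case True
    then have "int k < q" "int e < q" using insert.prems(1) by auto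
    then have "\<not> q dvd int k - int e" using that dvd_imp_le_int[of "int k - int e" q] by auto
    moreover have "q dvd (int k - int e) * coeff F k"
      using G by (simp add: const_poly_dvd_iff cG)
    ultimately show ?thesis using q by (simp add: prime_dvd_mult_iff)
  qed (use insert.prems in auto)
  \<comment> \<open>Only the term of exponent \<open>e\<close> is left. At least one order of
    vanishing is available, so its value at the unit \<open>d\<close> is 0 modulo
    \<open>q\<close>.\<close>
  have "[:q:] dvd F - monom (coeff F e) e" using other by (auto simp: const_poly_dvd_iff)
  from const_dvd_imp_dvd_poly[OF this, of d]
  have "q dvd poly F d - coeff F e * d ^ e" by (simp add: poly_monom)
  moreover have "q dvd poly F d" using div by (rule mod_dvd_imp_dvd_poly) simp
  ultimately have "q dvd coeff F e * d ^ e" by (metis dvd_diff_right_iff)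
  then have "q dvd coeff F e" using q d by (auto simp: prime_dvd_mult_iff dest: prime_dvd_power)
  then show ?case using other by (metis const_poly_dvd_iff)
qed

text \<open>Modulo \<open>Y\<close> only \<open>P 0\<close> survives, so it is divisible by
  \<open>Y\<close> and hence zero modulo \<open>q\<close>. The monic factor \<open>Y\<close> then
  cancels from the remaining sum, and the argument repeats.\<close>

lemma sum_power_mult_dvd_imp_zero:
  fixes Y :: "int poly"
  assumes q: "prime q" and Y: "lead_coeff Y = 1"
    and "\<And>c. c < C \<Longrightarrow> mod_dvd q Y (P c) \<Longrightarrow> [:q:] dvd P c"
    and "[:q:] dvd (\<Sum>c<C. Y ^ c * P c)" and "c < C"
  shows "[:q:] dvd P c"
  using assms(3-)
proof (induction C arbitrary: P c)
  case (Suc C)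
  let ?R = "\<Sum>c<C. Y ^ c * P (Suc c)"
  have eq: "(\<Sum>c<Suc C. Y ^ c * P c) = P 0 + Y * ?R"
    by (subst sum.lessThan_Suc_shift) (simp add: sum_distrib_left algebra_simps)
  then have "[:q:] dvd P 0 - Y * (- ?R)" using Suc.prems(2) by simp
  then have "mod_dvd q Y (P 0)" unfolding mod_dvd_def by blast
  then have P0: "[:q:] dvd P 0" using Suc.prems(1)[of 0] by simp
  then have "[:q:] dvd Y * ?R" using Suc.prems(2) unfolding eq by (simp only: dvd_add_right_iff)
  then have R: "[:q:] dvd ?R"
    using not_const_dvd_monic[OF q Y] by (simp only: const_dvd_mult_iff[OF q]) simp
  show ?case
  proof (cases c)
    case (Suc b)
    show ?thesis unfolding Suc
    proof (rule Suc.IH[of "\<lambda>c. P (Suc c)"])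
      fix c assume "c < C" "mod_dvd q Y (P (Suc c))"
      then show "[:q:] dvd P (Suc c)" by (intro Suc.prems(1)) simp_all
    qed (use R Suc Suc.prems(3) in simp_all)
  qed (use P0 in simp)
qed simp

section \<open>Homogeneous linear systems modulo \<open>q\<close>\<close>

text \<open>Pigeonhole: the \<open>q ^ card I\<close> reduced vectors have at most
  \<open>q ^ card J\<close> images, so two collide, and their difference is the solution.\<close>

lemma exists_nonzero_solution_mod:
  fixes M :: "'j \<Rightarrow> 'i \<Rightarrow> int"
  assumes q: "q > 1" and fin: "finite I" "finite J" and less: "card J < card I"
  shows "\<exists>x. (\<exists>i\<in>I. \<not> q dvd x i) \<and> (\<forall>j\<in>J. q dvd (\<Sum>i\<in>I. x i * M j i))"
proof -
  let ?X = "I \<rightarrow>\<^sub>E {0..<q}" and ?Y = "J \<rightarrow>\<^sub>E {0..<q}"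
  define f where "f = (\<lambda>x. \<lambda>j\<in>J. (\<Sum>i\<in>I. x i * M j i) mod q)"
  have "f ` ?X \<subseteq> ?Y" using q by (auto simp: f_def)
  moreover have "card ?Y < card ?X"
    using q fin less by (simp add: card_PiE power_strict_increasing)
  moreover have "finite ?Y" using fin by (intro finite_PiE) auto
  ultimately have "\<not> inj_on f ?X" by (metis card_inj_on_le not_le)
  then obtain x y where xy: "x \<in> ?X" "y \<in> ?X" "x \<noteq> y" "f x = f y" by (auto simp: inj_on_def)
  then obtain i where i: "i \<in> I" "x i \<noteq> y i" by (metis PiE_ext)
  have "x i \<in> {0..<q}" "y i \<in> {0..<q}" using xy i by auto
  then have "\<not> q dvd x i - y i" using i dvd_imp_le_int[of "x i - y i" q] by auto
  moreover have "q dvd (\<Sum>i\<in>I. (x i - y i) * M j i)" if "j \<in> J" for j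
  proof -
    have "(\<Sum>i\<in>I. x i * M j i) mod q = (\<Sum>i\<in>I. y i * M j i) mod q"
      using xy(4) that by (simp add: f_def fun_eq_iff) metis
    then show ?thesis by (simp add: mod_eq_dvd_iff algebra_simps sum_subtractf)
  qed
  ultimately show ?thesis using i by (intro exI[of _ "\<lambda>i. x i - y i"]) auto
qed

lemma mod_dvd_trans:
  assumes "V dvd W" "mod_dvd q W F"
  shows "mod_dvd q V F"
  using assms unfolding mod_dvd_def by (metis dvdE mult.assoc)

section \<open>The twisted derivation\<close>

text \<open>
  The operator \<open>X (X - d) d/dX\<close>, conjugated by multiplication with \<open>X^u (X - d)^v\<close>.
\<close>

definition twisted_deriv :: "int \<Rightarrow> nat \<Rightarrow> nat \<Rightarrow> int poly \<Rightarrow> int poly" where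
  "twisted_deriv d u v P = [:0, 1:] * [:-d, 1:] * pderiv P +
     (smult (int u) [:-d, 1:] + smult (int v) [:0, 1:]) * P"

lemma degree_twisted_deriv_le: "degree (twisted_deriv d u v P) \<le> degree P + 1"
proof -
  have "degree ([:0, 1:] * [:-d, 1:] * pderiv P) \<le> degree P + 1"
  \<comment> \<open>Constants are separate because \<open>degree P - 1\<close> is truncated at 0,
    which would make the estimate one too large.\<close>
  proof (cases "degree P = 0")
    case True
    then have "pderiv P = 0" by (simp add: pderiv_eq_0_iff)
    then show ?thesis by simp
  next
    case False
    have "degree ([:0, 1:] * [:-d, 1:] * pderiv P) \<le> degree ([:0, 1:] * [:-d, 1:]) + degree (pderiv P)"
      by (rule degree_mult_le)
    also have "\<dots> \<le> 2 + (degree P - 1)"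
      by (simp add: degree_pderiv)
    finally show ?thesis using False by simp
  qed
  moreover have "degree ((smult (int u) [:-d, 1:] + smult (int v) [:0, 1:]) * P) \<le> 1 + degree P"
    by (rule order.trans[OF degree_mult_le]) (simp add: degree_add_le)
  ultimately show ?thesis unfolding twisted_deriv_def by (intro degree_add_le) simp_all
qed

text \<open>Growth by one per step is what keeps the order \<open>k\<close> condition down to
  \<open>A + k\<close> linear equations.\<close>

lemma degree_funpow_twisted_deriv_le: "degree ((twisted_deriv d u v ^^ k) P) \<le> degree P + k"
proof (induction k)
  case (Suc k)
  then show ?case
    using degree_twisted_deriv_le[of d u v "(twisted_deriv d u v ^^ k) P"] by simp
qed simp

text \<open>The factor \<open>X (X - d)\<close> clears the denominators of the logarithmic
  derivatives \<open>u / X\<close> and \<open>v / (X - d)\<close>, so the two powers survive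
  differentiation as a common factor.\<close>

lemma derivation_twist:
  "[:0, 1:] * [:-d, 1:] * pderiv ([:0, 1:] ^ u * [:-d, 1:] ^ v * P) =
     [:0, 1:] ^ u * [:-d, 1:] ^ v * twisted_deriv d u v P"
proof -
  have power: "W * pderiv (W ^ k) = smult (int k) (W ^ k)" if "pderiv W = 1" for W :: "int poly" and k
    using that by (cases k) (simp_all only: pderiv_power_Suc, simp_all)
  define X Y where "X = [:0, 1::int:]" and "Y = [:-d, 1:]"
  have "pderiv X = 1" "pderiv Y = 1" by (simp_all add: X_def Y_def pderiv_pCons)
  note eq = this[THEN power]
  have "X * Y * pderiv (X ^ u * Y ^ v * P) =
      (X * pderiv (X ^ u)) * Y ^ v * Y * P + (Y * pderiv (Y ^ v)) * X ^ u * X * P +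
      X ^ u * Y ^ v * (X * Y * pderiv P)"
    by (simp add: pderiv_mult algebra_simps)
  also have "\<dots> = X ^ u * Y ^ v * (X * Y * pderiv P + (smult (int u) Y + smult (int v) X) * P)"
    unfolding eq by (simp add: algebra_simps)
  finally show ?thesis unfolding X_def Y_def twisted_deriv_def .
qed

lemma funpow_derivation_twist:
  "((\<lambda>F. [:0, 1:] * [:-d, 1:] * pderiv F) ^^ k) ([:0, 1:] ^ u * [:-d, 1:] ^ v * P) =
     [:0, 1:] ^ u * [:-d, 1:] ^ v * (twisted_deriv d u v ^^ k) P"
  by (induction k) (simp_all only: funpow.simps o_def id_apply derivation_twist)

lemma funpow_derivation_sum:
  fixes \<theta> :: "int poly"
  shows "((\<lambda>F. \<theta> * pderiv F) ^^ k) (\<Sum>i\<in>I. smult (x i) (f i)) =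
     (\<Sum>i\<in>I. smult (x i) (((\<lambda>F. \<theta> * pderiv F) ^^ k) (f i)))"
  by (induction k) (simp_all add: higher_pderiv_sum[of 1, simplified] pderiv_smult sum_distrib_left)

section \<open>Nonvanishing of the auxiliary polynomial\<close>

lemma coeff_sum_monom_inj:
  assumes "finite K" "inj_on e K" "i \<in> K"
  shows "coeff (\<Sum>i\<in>K. monom (x i) (e i)) (e i) = x i"
proof -
  have "coeff (\<Sum>i\<in>K. monom (x i) (e i)) (e i) = (\<Sum>j\<in>K. if j = i then x j else 0)"
    using assms by (auto simp: coeff_sum inj_on_eq_iff intro!: sum.cong)
  then show ?thesis using assms by simp
qed

text \<open>Collect the sum by powers of \<open>(X - d) ^ n\<close>. Each coefficient
  \<open>P c\<close> has at most \<open>A * B \<le> n\<close> terms, with exponents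
  \<open>a + m * b\<close> that are distinct because \<open>a < m\<close>; being sparse, it is
  divisible by \<open>(X - d) ^ n\<close> only if it is zero modulo \<open>q\<close>.\<close>

lemma aux_poly_nonzero:
  fixes x :: "nat \<times> nat \<times> nat \<Rightarrow> int"
  assumes q: "prime q" and d: "\<not> q dvd d" and A: "A \<le> m" "A * B \<le> n" "int (m * B) \<le> q"
    and "[:q:] dvd (\<Sum>(a, b, c)\<in>{..<A} \<times> {..<B} \<times> {..<B}.
          smult (x (a, b, c)) ([:0, 1:] ^ (m * b) * [:-d, 1:] ^ (n * c) * monom 1 a))"
    and "a < A" "b < B" "c < B"
  shows "q dvd x (a, b, c)"
proof -
  let ?Y = "[:-d, 1:]"
  define K where "K = {..<A} \<times> {..<B}"
  define e where "e = (\<lambda>(a, b). a + m * b)"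
  have "finite K" by (simp add: K_def)
  have e: "inj_on e K"
  proof (rule inj_onI, clarify)
    fix a b a' b' assume *: "(a, b) \<in> K" "(a', b') \<in> K" "e (a, b) = e (a', b')"
    then have "a < m" "a' < m" using A by (auto simp: K_def)
    with *(3) have "a = a'" by (metis e_def case_prod_conv mod_less mod_mult_self2)
    with * \<open>a < m\<close> show "a = a' \<and> b = b'" by (auto simp: e_def)
  qed
  define P where "P = (\<lambda>c. \<Sum>i\<in>K. monom (x (fst i, snd i, c)) (e i))"
  have "(\<Sum>(a, b, c)\<in>{..<A} \<times> {..<B} \<times> {..<B}.
          smult (x (a, b, c)) ([:0, 1:] ^ (m * b) * ?Y ^ (n * c) * monom 1 a)) =
        (\<Sum>(a, b, c)\<in>{..<A} \<times> {..<B} \<times> {..<B}. (?Y ^ n) ^ c * monom (x (a, b, c)) (a + m * b))"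
    by (intro sum.cong)
       (auto simp: power_mult monom_altdef power_add power_mult_distrib mult_ac simp flip: power_mult)
  also have "\<dots> = (\<Sum>c<B. (?Y ^ n) ^ c * P c)"
    unfolding P_def sum_distrib_left sum.cartesian_product
    by (rule sum.reindex_bij_witness[of _ "\<lambda>(c, (a, b)). (a, b, c)" "\<lambda>(a, b, c). (c, (a, b))"])
       (auto simp: K_def e_def)
  finally have dvd: "[:q:] dvd (\<Sum>c<B. (?Y ^ n) ^ c * P c)" using assms(6) by simp
  have "[:q:] dvd P c"
  proof (rule sum_power_mult_dvd_imp_zero[OF q _ _ dvd \<open>c < B\<close>])
    fix c assume "mod_dvd q (?Y ^ n) (P c)"
    have "card (e ` K) \<le> n"
      using A card_image_le[OF \<open>finite K\<close>, of e] by (simp add: K_def)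
    then have "mod_dvd q (?Y ^ card (e ` K)) (P c)"
      using \<open>mod_dvd q (?Y ^ n) (P c)\<close> by (rule mod_dvd_trans[OF le_imp_power_dvd])
    then show "[:q:] dvd P c"
    proof (rule sparse_mod_dvd_imp_zero[OF q d, rotated 3])
      fix k assume "k \<in> e ` K"
      then obtain a b where *: "k = a + m * b" "a < A" "b < B" by (auto simp: e_def K_def)
      then have "k < m * Suc b" using A by simp
      also have "\<dots> \<le> m * B" using * by (intro mult_le_mono) auto
      finally show "int k < q" using A by linarith
    next
      fix k assume "k \<notin> e ` K"
      then have "coeff (P c) k = 0" by (auto simp: P_def coeff_sum intro!: sum.neutral)
      then show "q dvd coeff (P c) k" by simp
    qed (use \<open>finite K\<close> in simp)
  qed (simp add: lead_coeff_power)
  then have "q dvd coeff (P c) (e (a, b))" by (simp only: const_poly_dvd_iff)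
  also have "coeff (P c) (e (a, b)) = x (a, b, c)"
    unfolding P_def using \<open>finite K\<close> e assms(7-)
    by (subst coeff_sum_monom_inj) (auto simp: K_def)
  finally show ?thesis .
qed

section \<open>Stepanov's bound for common roots\<close>

text \<open>At every common root the twisting powers equal 1, so the \<open>k\<close>-th derivative
  of \<open>F\<close> agrees there with one polynomial of degree below \<open>A + k\<close>, the
  same for all roots. Killing its coefficients for each \<open>k < D\<close> makes \<open>F\<close>
  vanish to order \<open>D\<close> at all of them at once.\<close>

lemma stepanov_bound:
  assumes q: "prime q" and d: "\<not> q dvd d" and A: "A \<le> m" "A * B \<le> n" "int (m * B) \<le> q"
    and D: "int D \<le> q" "(\<Sum>k<D. A + k) < A * (B * B)"
    and S: "finite S" "inj_on (\<lambda>s. s mod q) S"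
    and roots: "\<And>s. s \<in> S \<Longrightarrow> q dvd s ^ m - 1" "\<And>s. s \<in> S \<Longrightarrow> q dvd (s - d) ^ n - 1"
  shows "D * card S \<le> A - 1 + (m + n) * (B - 1)"
proof -
  let ?X = "[:0, 1:]" and ?Y = "[:-d, 1:]"
  define I where "I = {..<A} \<times> {..<B} \<times> {..<B}"
  \<comment> \<open>\<open>(k, j)\<close> stands for the equation that kills the coefficient of
    \<open>X ^ j\<close> at order \<open>k\<close>.\<close>
  define J where "J = Sigma {..<D} (\<lambda>k. {..<A + k})"
  define R where "R = (\<lambda>k (a, b, c). (twisted_deriv d (m * b) (n * c) ^^ k) (monom 1 a))"
  have fin: "finite I" "finite J" by (simp_all add: I_def J_def)
  have "card J < card I" using D by (simp add: I_def J_def)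
  then obtain x where nz: "\<exists>i\<in>I. \<not> q dvd x i"
      and "\<forall>j\<in>J. q dvd (\<Sum>i\<in>I. x i * coeff (R (fst j) i) (snd j))"
    using exists_nonzero_solution_mod[OF _ fin, of q "\<lambda>j i. coeff (R (fst j) i) (snd j)"] q
    by (auto simp: prime_gt_1_int)
  then have eqs: "q dvd (\<Sum>i\<in>I. x i * coeff (R k i) j)" if "k < D" "j < A + k" for k j
    using that by (force simp: J_def)
  define f where "f = (\<lambda>(a, b, c). ?X ^ (m * b) * ?Y ^ (n * c) * monom (1::int) a)"
  define F where "F = (\<Sum>i\<in>I. smult (x i) (f i))"
  have "A > 0" "B > 0" using D by (auto intro!: gr0I)
  then have pos: "m > 0" "n > 0" using A by (auto intro!: gr0I)

  have vanish: "mod_dvd q ([:-s, 1:] ^ D) F" if s: "s \<in> S" for s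
  proof (rule mod_dvd_power_derivation[OF q _ D(1)])
    have "\<not> q dvd s"
      using roots(1)[OF s] pos q
      by (metis dvd_diff_right_iff dvd_power dvd_trans not_prime_unit)
    moreover have "\<not> q dvd s - d"
      using roots(2)[OF s] pos q
      by (metis dvd_diff_right_iff dvd_power dvd_trans not_prime_unit)
    ultimately show "\<not> q dvd poly (?X * ?Y) s" using q by (simp add: prime_dvd_mult_iff)
  next
    fix k assume "k < D"
    have deg: "degree (R k i) < A + k" if "i \<in> I" for i
    proof -
      from that obtain a b c where i: "i = (a, b, c)" "a < A" by (auto simp: I_def)
      have "degree (R k i) \<le> degree (monom (1::int) a) + k"
        unfolding R_def i by (simp only: prod.case degree_funpow_twisted_deriv_le)
      then show ?thesis using i by (simp add: degree_monom_eq)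
    qed
    have "[:q:] dvd (\<Sum>i\<in>I. smult (x i) (R k i))"
    proof (subst const_poly_dvd_iff, intro allI)
      fix j
      show "q dvd coeff (\<Sum>i\<in>I. smult (x i) (R k i)) j"
      proof (cases "j < A + k")
        case True
        then show ?thesis using eqs[OF \<open>k < D\<close> True] by (simp add: coeff_sum)
      next
        case False
        then have "coeff (\<Sum>i\<in>I. smult (x i) (R k i)) j = 0"
          unfolding coeff_sum using deg by (intro sum.neutral) (force intro: coeff_eq_0)
        then show ?thesis by simp
      qed
    qed
    from const_dvd_imp_dvd_poly[OF this, of s]
    have 1: "q dvd (\<Sum>i\<in>I. x i * poly (R k i) s)" by (simp add: poly_sum)
    have eq: "poly (((\<lambda>F. ?X * ?Y * pderiv F) ^^ k) F) s =
        (\<Sum>i\<in>I. x i * (s ^ (m * fst (snd i)) * (s - d) ^ (n * snd (snd i)) * poly (R k i) s))"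
      unfolding F_def funpow_derivation_sum poly_sum f_def R_def
      by (intro sum.cong refl) (auto simp only: prod.case funpow_derivation_twist, simp)
    have "[s ^ (m * b) * (s - d) ^ (n * c) = 1] (mod q)" for b c
    proof -
      have "[s ^ m = 1] (mod q)" "[(s - d) ^ n = 1] (mod q)"
        using roots[OF s] by (simp_all add: cong_iff_dvd_diff)
      then have "[(s ^ m) ^ b * ((s - d) ^ n) ^ c = 1 ^ b * 1 ^ c] (mod q)"
        by (intro cong_mult cong_pow)
      then show ?thesis by (simp add: power_mult)
    qed
    then have "[(\<Sum>i\<in>I. x i * (s ^ (m * fst (snd i)) * (s - d) ^ (n * snd (snd i)) * poly (R k i) s)) =
        (\<Sum>i\<in>I. x i * (1 * poly (R k i) s))] (mod q)"
      by (intro cong_sum cong_mult cong_refl)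
    then show "q dvd poly (((\<lambda>F. ?X * ?Y * pderiv F) ^^ k) F) s"
      unfolding eq using 1 by (simp add: cong_dvd_iff)
  qed

  have "\<not> [:q:] dvd F"
  proof
    assume *: "[:q:] dvd F"
    have "F = (\<Sum>(a, b, c)\<in>{..<A} \<times> {..<B} \<times> {..<B}.
          smult (x (a, b, c)) (?X ^ (m * b) * ?Y ^ (n * c) * monom 1 a))"
      by (simp add: F_def f_def I_def split_beta)
    with * have "q dvd x i" if "i \<in> I" for i
      using that aux_poly_nonzero[OF q d A, of x] by (auto simp: I_def)
    with nz show False by blast
  qed
  with vanish have "D * card S \<le> degree F"
    by (intro mult_card_roots_le_degree[OF q S])
  also have "degree F \<le> A - 1 + (m + n) * (B - 1)"
    unfolding F_def
  proof (rule degree_sum_le[OF fin(1)])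
    fix i assume "i \<in> I"
    then obtain a b c where i: "i = (a, b, c)" "a < A" "b < B" "c < B" by (auto simp: I_def)
    have "degree (f i) = m * b + n * c + a"
      by (simp add: f_def i degree_mult_eq degree_power_eq degree_monom_eq)
    also have "\<dots> \<le> m * (B - 1) + n * (B - 1) + (A - 1)"
      using i by (intro add_mono mult_le_mono) auto
    also have "\<dots> = A - 1 + (m + n) * (B - 1)" by (simp add: add_mult_distrib)
    finally show "degree (smult (x i) (f i)) \<le> A - 1 + (m + n) * (B - 1)"
      using degree_smult_le order.trans by blast
  qed
  finally show ?thesis .
qed

section \<open>Elementary bounds from polynomials of small degree\<close>

lemma card_roots_of_unity_mod_le:
  fixes q :: int
  assumes q: "prime q" and "0 < m" and S: "finite S" "inj_on (\<lambda>s. s mod q) S"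
    and roots: "\<And>s. s \<in> S \<Longrightarrow> q dvd s ^ m - 1"
  shows "card S \<le> m"
proof -
  let ?F = "monom 1 m + [:-1:] :: int poly"
  have "degree ?F = m"
    using \<open>0 < m\<close> by (subst degree_add_eq_left) (simp_all add: degree_monom_eq)
  moreover from this have "lead_coeff ?F = 1" using \<open>0 < m\<close> by (cases m) simp_all
  moreover have "mod_dvd q ([:-s, 1:] ^ 1) ?F" if "s \<in> S" for s
    using roots[OF that] by (simp add: mod_dvd_linear_iff poly_monom)
  ultimately show ?thesis
    using mult_card_roots_le_degree[OF q S, of 1 ?F] not_const_dvd_monic[OF q] by simp
qed

lemma coeff_linear_power_pred: "coeff ([:a, 1::int:] ^ Suc n) n = int (Suc n) * a"
proof (induction n)
  case (Suc n)
  have "[:a, 1:] ^ Suc (Suc n) = smult a ([:a, 1:] ^ Suc n) + pCons 0 ([:a, 1:] ^ Suc n)" by simp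
  then show ?case
    by (simp only: coeff_add coeff_smult coeff_pCons_Suc coeff_linear_power Suc)
       (simp add: algebra_simps)
qed simp

text \<open>In \<open>X ^ m - (X - d) ^ m\<close> the leading terms cancel, and the next coefficient
  \<open>m * d\<close> is nonzero modulo \<open>q\<close>; this degree drop saves one root.\<close>

lemma card_common_roots_less:
  assumes q: "prime q" and d: "\<not> q dvd d" and m: "0 < m" "int m < q"
    and S: "finite S" "inj_on (\<lambda>s. s mod q) S"
    and roots: "\<And>s. s \<in> S \<Longrightarrow> q dvd s ^ m - 1" "\<And>s. s \<in> S \<Longrightarrow> q dvd (s - d) ^ m - 1"
  shows "card S < m"
proof -
  obtain k where k: "m = Suc k" using m by (cases m) auto
  let ?F = "monom 1 m - [:-d, 1:] ^ m"
  have "\<not> q dvd int m * d"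
    using q d m by (auto simp: prime_dvd_mult_iff dest: zdvd_imp_le)
  also have "int m * d = coeff ?F k"
    unfolding k coeff_diff coeff_linear_power_pred by simp
  finally have "\<not> [:q:] dvd ?F" unfolding const_poly_dvd_iff by blast
  moreover have "mod_dvd q ([:-s, 1:] ^ 1) ?F" if "s \<in> S" for s
  proof -
    have "q dvd (s ^ m - 1) - ((s - d) ^ m - 1)" using roots[OF that] by (rule dvd_diff)
    then show ?thesis by (simp add: mod_dvd_linear_iff poly_monom)
  qed
  ultimately have "card S \<le> degree ?F"
    using mult_card_roots_le_degree[OF q S, of 1 ?F] by simp
  also have "degree ?F \<le> k"
  proof (rule degree_le, intro allI impI)
    fix i assume "k < i"
    then show "coeff ?F i = 0"
      using coeff_linear_power[of "-d" m]
      by (cases "i = m") (simp_all add: k coeff_eq_0 degree_linear_power del: power_Suc)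
  qed
  finally show ?thesis using k by simp
qed

section \<open>Choice of parameters and numerical estimates\<close>

lemma le_powr_26_27:
  fixes N n :: nat
  assumes "N ^ 27 \<le> n ^ 26"
  shows "real N \<le> real n powr (26 / 27)"
proof -
  have "real N = (real N powr 27) powr (1 / 27)" unfolding powr_powr by simp
  also have "\<dots> = (real N ^ 27) powr (1 / 27)" by simp
  also have "\<dots> \<le> (real n ^ 26) powr (1 / 27)"
    using assms by (intro powr_mono2) (simp_all flip: of_nat_power)
  also have "\<dots> = (real n powr 26) powr (1 / 27)" by simp
  also have "\<dots> = real n powr (26 / 27)" unfolding powr_powr by simp
  finally show ?thesis .
qed

lemma common_roots_bound:
  assumes q: "prime q" and d: "\<not> q dvd d" and m: "0 < m" "m \<le> n" "int (n ^ 2) \<le> q"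
    and S: "finite S" "inj_on (\<lambda>s. s mod q) S"
    and roots: "\<And>s. s \<in> S \<Longrightarrow> q dvd s ^ m - 1" "\<And>s. s \<in> S \<Longrightarrow> q dvd (s - d) ^ n - 1"
  shows "card S ^ 27 \<le> n ^ 26"
proof -
  have le_m: "card S \<le> m" using q m S roots by (intro card_roots_of_unity_mod_le) auto
  have le_q: "int k \<le> q" if "k \<le> n * n" for k
    using m(3) of_nat_mono[OF that] unfolding power2_eq_square by (rule order.trans[rotated])
  note stepanov = stepanov_bound[OF q d _ _ _ _ _ S roots]
  consider "n \<le> 7" | "8 \<le> n" "n < 256" | "256 \<le> n" by linarith
  then show ?thesis
  proof cases
    case 1
    \<comment> \<open>For \<open>m < n\<close> the bound \<open>m\<close> is enough; only
      \<open>m = n\<close> calls for the degree drop.\<close>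
    have *: "card S < n" if "n \<noteq> 1"
    proof (cases "m = n")
      case True
      have "n + 1 \<le> n * n" using that m by (cases n) auto
      from le_q[OF this] have "int n < q" by simp
      then show ?thesis using True card_common_roots_less[OF q d _ _ S, of n] m roots by simp
    qed (use m le_m in simp)
    show ?thesis
    proof (cases "n = 1")
      case False
      then have "card S \<le> n - 1" using * by simp
      then have "card S ^ 27 \<le> (n - 1) ^ 27" by (rule power_mono) simp
      also have "n \<in> {2, 3, 4, 5, 6, 7}" using 1 False m by auto
      then have "(n - 1) ^ 27 \<le> n ^ 26" by auto
      finally show ?thesis .
    qed (use le_m m power_mono[of "card S" 1 27] in simp)
  next
    case 2
    \<comment> \<open>Stepanov's bound gives \<open>3 * card S \<le> 3 + 2 * n\<close>, and
      \<open>24 \<le> 3 * n\<close>.\<close>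
    have "24 * card S \<le> 19 * n"
    proof (cases "4 \<le> m")
      case True
      \<comment> \<open>Here \<open>4 + 5 + 6 = 15\<close> equations face
        \<open>4 * 2 * 2 = 16\<close> unknowns, and \<open>A * B = 8 \<le> n\<close>.\<close>
      have "3 * card S \<le> 4 - 1 + (m + n) * (2 - 1)"
      proof (rule stepanov)
        show "int (m * 2) \<le> q" using 2 m by (intro le_q mult_le_mono) auto
        have "3 \<le> n" using 2 by simp
        also have "\<dots> \<le> n * n" using 2 by simp
        finally have "int 3 \<le> q" by (rule le_q)
        then show "int 3 \<le> q" .
      qed (use 2 True in \<open>simp_all add: numeral_3_eq_3\<close>)
      then show ?thesis using 2 m by simp
    qed (use 2 le_m in simp)
    then have "(24 * card S) ^ 27 \<le> (19 * n) ^ 27" by (rule power_mono) simp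
    then have "24 ^ 27 * card S ^ 27 \<le> 19 ^ 27 * (n * n ^ 26)"
      by (simp only: power_mult_distrib flip: power_Suc) simp
    also have "\<dots> \<le> 19 ^ 27 * (256 * n ^ 26)" using 2 by (intro mult_le_mono) auto
    also have "\<dots> = 19 ^ 27 * 256 * n ^ 26" by (rule mult.assoc[symmetric])
    also have "\<dots> \<le> 24 ^ 27 * n ^ 26" by (intro mult_le_mono) auto
    finally show ?thesis by simp
  next
    case 3
    \<comment> \<open>\<open>r\<close> is taken maximal with \<open>4 * r ^ 3 \<le> n\<close>, which
      is the condition \<open>A * B \<le> n\<close> for \<open>A = 2 * r ^ 2\<close> and
      \<open>B = 2 * r\<close>.\<close>
    have "n < 4 * Suc n ^ 3" using self_le_power[of "Suc n" 3] by simp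
    then obtain r where r: "4 * r ^ 3 \<le> n" and less: "n < 4 * Suc r ^ 3"
      using ex_least_nat_less[of "\<lambda>k. n < 4 * k ^ 3" "Suc n"] by (force simp: not_less)
    have "4 \<le> r"
    proof (rule ccontr)
      assume "\<not> 4 \<le> r"
      then have "Suc r ^ 3 \<le> 4 ^ 3" by (intro power_mono) auto
      with less 3 show False by simp
    qed
    have "n \<le> 4 * Suc r ^ 3" using less by (rule less_imp_le)
    also have "\<dots> \<le> 4 * (2 * r) ^ 3" using \<open>4 \<le> r\<close> by (intro mult_le_mono power_mono) auto
    also have "\<dots> = 32 * r ^ 3" by (simp add: power_mult_distrib)
    finally have n: "n \<le> 32 * r ^ 3" .
    have cube: "4 * (r * r ^ 2) \<le> n" using r by (simp add: power3_eq_cube power2_eq_square)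
    have sq: "r ^ 2 \<le> r * r ^ 2" using \<open>4 \<le> r\<close> by simp
    have sqn: "2 * r ^ 2 \<le> n" using cube sq by linarith
    have rr: "r \<le> r ^ 2" using \<open>4 \<le> r\<close> by (simp add: power2_eq_square)
    have "r * card S \<le> 2 * n"
    \<comment> \<open>Stepanov's bound requires \<open>A \<le> m\<close>; for smaller
      \<open>m\<close> the bound \<open>card S \<le> m\<close> is already good enough.\<close>
    proof (cases "2 * r ^ 2 \<le> m")
      case True
      have "2 * r ^ 2 * card S \<le> 2 * r ^ 2 - 1 + (m + n) * (2 * r - 1)"
      proof (rule stepanov)
        show "2 * r ^ 2 \<le> m" by fact
        show "2 * r ^ 2 * (2 * r) \<le> n" using cube by (simp add: algebra_simps)
        have "2 * r \<le> n" using cube sq rr by linarith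
        then show "int (m * (2 * r)) \<le> q" using m by (intro le_q mult_le_mono)
        have "n \<le> n * n" using 3 by simp
        with sqn show "int (2 * r ^ 2) \<le> q" by (intro le_q) linarith
        \<comment> \<open>Since \<open>k < 2 * r ^ 2\<close>, each order contributes fewer than
          \<open>4 * r ^ 2 = B * B\<close> equations.\<close>
        have "(\<Sum>k<2 * r ^ 2. 2 * r ^ 2 + k) < (\<Sum>k<2 * r ^ 2. 4 * r ^ 2)"
          using \<open>4 \<le> r\<close> by (intro sum_strict_mono) (auto simp: lessThan_empty_iff)
        also have "\<dots> = 2 * r ^ 2 * (2 * r * (2 * r))" by (simp add: power2_eq_square)
        finally show "(\<Sum>k<2 * r ^ 2. 2 * r ^ 2 + k) < 2 * r ^ 2 * (2 * r * (2 * r))" .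
      qed
      \<comment> \<open>Bounding \<open>A - 1\<close> generously by \<open>2 * n\<close> turns the
        factor \<open>B - 1\<close> into \<open>B\<close>.\<close>
      also have "\<dots> \<le> 2 * n + (2 * n) * (2 * r - 1)"
        using m sqn by (intro add_mono mult_le_mono) auto
      also have "\<dots> = 2 * n * (2 * r)" using \<open>4 \<le> r\<close> by (cases r) simp_all
      finally have "(2 * r) * (r * card S) \<le> (2 * r) * (2 * n)"
        by (simp add: power2_eq_square mult_ac)
      then show ?thesis using \<open>4 \<le> r\<close> by simp
    next
      case False
      then have "r * card S \<le> r * (2 * r ^ 2)" using le_m by (intro mult_le_mono) auto
      then show ?thesis using cube by linarith
    qed
    then have "(r * card S) ^ 27 \<le> (2 * n) ^ 27" by (rule power_mono) simp
    then have "r ^ 27 * card S ^ 27 \<le> 2 ^ 27 * (n * n ^ 26)"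
      by (simp only: power_mult_distrib flip: power_Suc) simp
    also have "\<dots> \<le> 2 ^ 27 * (32 * r ^ 3 * n ^ 26)" using n by (intro mult_le_mono) auto
    also have "\<dots> = 2 ^ 32 * r ^ 3 * n ^ 26" by simp
    also have "\<dots> \<le> r ^ 24 * r ^ 3 * n ^ 26"
    proof (intro mult_le_mono)
      have "(2::nat) ^ 32 \<le> 4 ^ 24" by simp
      also have "\<dots> \<le> r ^ 24" using \<open>4 \<le> r\<close> by (intro power_mono) auto
      finally show "2 ^ 32 \<le> r ^ 24" .
    qed auto
    also have "\<dots> = r ^ 27 * n ^ 26" by (simp flip: power_add)
    finally show ?thesis using \<open>4 \<le> r\<close> by simp
  qed
qed

section \<open>Subgroups of the multiplicative group and the count of solutions\<close>

lemma (in group) subgroup_pow_card: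
  assumes "subgroup H G" "x \<in> H"
  shows "x [^] card H = \<one>"
proof -
  interpret H: group "G\<lparr>carrier := H\<rparr>" using assms(1) by (rule subgroup_imp_group)
  have "x [^]\<^bsub>G\<lparr>carrier := H\<rparr>\<^esub> Coset.order (G\<lparr>carrier := H\<rparr>) = \<one>\<^bsub>G\<lparr>carrier := H\<rparr>\<^esub>"
    using assms by (intro H.pow_order_eq_1) simp
  then show ?thesis by (simp add: Coset.order_def flip: nat_pow_consistent)
qed

context residues_prime
begin

lemma subgroup_mult_ofD:
  assumes "subgroup H (mult_of R)"
  shows "finite H" "H \<subseteq> {1..<int p}" "0 < card H"
    and "\<And>x. x \<in> H \<Longrightarrow> int p dvd x ^ card H - 1"
proof -
  interpret M: group "mult_of R" by (rule field_mult_group)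
  show sub: "H \<subseteq> {1..<int p}"
    using subgroup.subset[OF assms] by (auto simp: res_carrier_eq res_zero_eq)
  then show "finite H" by (rule finite_subset) simp
  then show "0 < card H" using subgroup.one_closed[OF assms] by (auto simp: card_gt_0_iff)
  fix x assume x: "x \<in> H"
  have "x mod int p = x" using x sub by auto
  moreover have "x [^] card H = 1"
    using M.subgroup_pow_card[OF assms x] by (simp add: nat_pow_mult_of res_one_eq)
  ultimately have "x ^ card H mod int p = 1" using pow_cong[of x "card H"] by simp
  then have "x ^ card H mod int p = 1 mod int p" using m_gt_one by simp
  then show "int p dvd x ^ card H - 1" by (simp add: mod_eq_dvd_iff)
qed

text \<open>Since \<open>g\<close> determines \<open>h\<close>, counting solutions amounts to
  counting common roots \<open>g\<close> of \<open>X ^ card G - 1\<close> and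
  \<open>(X - d) ^ card H - 1\<close>.\<close>

lemma card_differences_bound:
  assumes G: "subgroup G (mult_of R)" and H: "subgroup H (mult_of R)"
    and le: "card G ^ 2 \<le> p" "card H ^ 2 \<le> p"
    and d: "d \<in> carrier R" "d \<noteq> \<zero>"
  shows "card {(g, h). g \<in> G \<and> h \<in> H \<and> g \<ominus> h = d} ^ 27 \<le> max (card G) (card H) ^ 26"
proof -
  note G = subgroup_mult_ofD[OF G] and H = subgroup_mult_ofD[OF H]
  define Sol where "Sol = {(g, h). g \<in> G \<and> h \<in> H \<and> g \<ominus> h = d}"
  have q: "prime (int p)" using p_prime by simp
  have "0 < d" "d < int p" using d by (auto simp: res_carrier_eq res_zero_eq)
  then have nd: "\<not> int p dvd d" by (auto dest: zdvd_imp_le)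
  have diff: "[g - h = d] (mod int p)" if "(g, h) \<in> Sol" for g h
  proof -
    have "(g - h) mod int p = d"
      using that by (simp add: Sol_def a_minus_def res_add_eq res_neg_eq mod_simps)
    then show ?thesis using \<open>0 < d\<close> \<open>d < int p\<close> by (simp add: cong_def)
  qed
  have "finite Sol" by (rule finite_subset[of _ "G \<times> H"]) (use G H in \<open>auto simp: Sol_def\<close>)
  have inj_mod: "inj_on (\<lambda>s. s mod int p) {1..<int p}" by (auto intro: inj_onI)
  have "inj_on fst Sol"
  proof (rule inj_onI)
    fix x y assume *: "x \<in> Sol" "y \<in> Sol" "fst x = fst y"
    then have "[fst x - snd x = fst x - snd y] (mod int p)"
      using diff[of "fst x" "snd x"] diff[of "fst x" "snd y"]
      by (metis cong_sym cong_trans prod.collapse)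
    then have "[snd x = snd y] (mod int p)" by (simp add: cong_iff_dvd_diff dvd_diff_commute)
    moreover have "snd x \<in> {1..<int p}" "snd y \<in> {1..<int p}" using * H by (auto simp: Sol_def)
    ultimately show "x = y" using * by (auto simp: cong_def prod_eq_iff)
  qed
  then have card: "card (fst ` Sol) = card Sol" by (rule card_image)
  have inj: "inj_on (\<lambda>s. s mod int p) (fst ` Sol)"
    by (rule inj_on_subset[OF inj_mod]) (use G in \<open>auto simp: Sol_def\<close>)
  have roots: "int p dvd s ^ card G - 1" "int p dvd (s - d) ^ card H - 1" if "s \<in> fst ` Sol" for s
  proof -
    from that obtain h where h: "(s, h) \<in> Sol" by auto
    then show "int p dvd s ^ card G - 1" using G by (auto simp: Sol_def)
    have "[s - d = h] (mod int p)"
      using diff[OF h] by (simp add: cong_iff_dvd_diff dvd_diff_commute algebra_simps)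
    then have "[(s - d) ^ card H = h ^ card H] (mod int p)" by (rule cong_pow)
    also have "[h ^ card H = 1] (mod int p)"
      using h H by (auto simp: Sol_def cong_iff_dvd_diff)
    finally show "int p dvd (s - d) ^ card H - 1" by (simp add: cong_iff_dvd_diff)
  qed
  have "card Sol ^ 27 \<le> max (card G) (card H) ^ 26"
  proof (cases "card G \<le> card H")
    case True
    have "card (fst ` Sol) ^ 27 \<le> card H ^ 26"
      by (rule common_roots_bound[OF q nd, of "card G"])
         (use True G H le inj roots \<open>finite Sol\<close> in auto)
    then show ?thesis using True card by (simp add: max_def)
  next
    case False
    \<comment> \<open>The larger order must belong to the shifted polynomial, so roles are
      exchanged: \<open>g - d\<close>, congruent to \<open>h\<close>, is the root and
      \<open>-d\<close> the shift. These values need not be reduced, so distinctness is only asked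
      modulo \<open>p\<close>.\<close>
    let ?S = "(\<lambda>s. s - d) ` fst ` Sol"
    have "inj_on (\<lambda>s. s mod int p) ?S"
      using inj by (auto simp: inj_on_def mod_eq_dvd_iff)
    moreover have "int p dvd s ^ card H - 1" "int p dvd (s - - d) ^ card G - 1" if "s \<in> ?S" for s
      using that roots by force+
    ultimately have "card ?S ^ 27 \<le> card G ^ 26"
      using False G H le \<open>finite Sol\<close> nd
      by (intro common_roots_bound[OF q, of "- d" "card H"]) auto
    moreover have "card ?S = card Sol" unfolding card[symmetric] by (intro card_image inj_onI) simp
    ultimately show ?thesis using False by (simp add: max_def)
  qed
  then show ?thesis by (simp add: Sol_def)
qed

end

theorem corollary1:
  fixes p :: nat and G H :: "int set" and d :: int
  assumes "prime p"
    and "subgroup G (mult_of (residue_ring (int p)))"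
    and "subgroup H (mult_of (residue_ring (int p)))"
    and "real (card G) \<le> sqrt (real p)"
    and "real (card H) \<le> sqrt (real p)"
    and "d \<in> carrier (residue_ring (int p))"
    and "d \<noteq> \<zero>\<^bsub>residue_ring (int p)\<^esub>"
  shows "real (card {(g, h). g \<in> G \<and> h \<in> H \<and> g \<ominus>\<^bsub>residue_ring (int p)\<^esub> h = d})
    \<le> real (max (card G) (card H)) powr (26 / 27)"
proof -
  interpret residues_prime p "residue_ring (int p)"
    by unfold_locales fact
  have "k ^ 2 \<le> p" if "real k \<le> sqrt (real p)" for k
  proof -
    have "real k ^ 2 \<le> sqrt (real p) ^ 2" using that by (rule power_mono) simp
    then show ?thesis by (simp flip: of_nat_power)
  qed
  with assms show ?thesis
    by (intro le_powr_26_27 card_differences_bound) auto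
qed

end
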